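(* For every integer $m\ge 6$, $$F(m)\ge\frac12 m^2-2m+3.$$ Consequently, for every integer $m\ge 2$, $$F(m)\ge\frac12 m^2-2m,$$ and therefore $$\liminf_{m\to\infty}\frac{F(m)}{m^2}\ge\frac12.$$
   Context: For an integer $m\ge 2$, the grid is $G_m=\{1,\dots,m\}\times\{1,\dots,m\}$; its elements are called squares, and $(i,j)$ is the square in row $i$ and column $j$. For integers $1\le a,b\le m-1$, the card $C_{a,b}$ is the set $\{(a,b),(a+1,b),(a,b+1),(a+1,b+1)\}$, and $\mathcal C_m=\{C_{a,b}:1\le a,b\le m-1\}$. A configuration is a non-empty subset $U\subseteq\mathcal C_m$. The multiplicity of $x\in G_m$ is $\mu(x)=|\{C\in U: x\in C\}|$. A square $x$ is private for $C\in U$ if $x\in C$ and $\mu(x)=1$. $U$ is an irredundant cover of $G_m$ if $\mu(x)\ge 1$ for every $x\in G_m$ and every $C\in U$ contains at least one private square. $F(m)=\max\{|U|: U\subseteq\mathcal C_m\text{ is an irredundant cover of }G_m\}$. *)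

theory Defs
  imports Complex_Main "HOL-Library.Extended_Real"
begin

text \<open>Squares are pairs (row, column) with 1-based coordinates. The word ``card'' of the source
  (a 2-by-2 block of squares) is rendered as \<open>block\<close>, since \<open>card\<close> is the cardinality function.\<close>

definition grid :: "nat \<Rightarrow> (nat \<times> nat) set" where
  "grid m = {1..m} \<times> {1..m}"

definition block :: "nat \<Rightarrow> nat \<Rightarrow> (nat \<times> nat) set" where
  "block a b = {(a, b), (a + 1, b), (a, b + 1), (a + 1, b + 1)}"

definition blocks :: "nat \<Rightarrow> (nat \<times> nat) set set" where
  "blocks m = {block a b | a b. 1 \<le> a \<and> a \<le> m - 1 \<and> 1 \<le> b \<and> b \<le> m - 1}"

definition configuration :: "nat \<Rightarrow> (nat \<times> nat) set set \<Rightarrow> bool" where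
  "configuration m U \<longleftrightarrow> U \<noteq> {} \<and> U \<subseteq> blocks m"

definition multiplicity :: "(nat \<times> nat) set set \<Rightarrow> nat \<times> nat \<Rightarrow> nat" where
  "multiplicity U x = card {C \<in> U. x \<in> C}"

definition private_square :: "(nat \<times> nat) set set \<Rightarrow> (nat \<times> nat) set \<Rightarrow> nat \<times> nat \<Rightarrow> bool" where
  "private_square U C x \<longleftrightarrow> C \<in> U \<and> x \<in> C \<and> multiplicity U x = 1"

definition irredundant_cover :: "nat \<Rightarrow> (nat \<times> nat) set set \<Rightarrow> bool" where
  "irredundant_cover m U \<longleftrightarrow>
     configuration m U \<and>
     (\<forall>x \<in> grid m. multiplicity U x \<ge> 1) \<and>
     (\<forall>C \<in> U. \<exists>x. private_square U C x)"

text \<open>Only the values at \<open>m \<ge> 2\<close> are meaningful: for \<open>m < 2\<close> there is no configuration and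
  \<open>Max {}\<close> is unspecified. For \<open>m \<ge> 2\<close> the set below is finite, because \<open>blocks m\<close> is, and
  non-empty, because \<open>blocks m\<close> covers the grid and every inclusion-minimal subcover is irredundant.\<close>

definition F :: "nat \<Rightarrow> nat" where
  "F m = Max {card U | U. irredundant_cover m U}"

end

theory Submission
  imports Defs
begin

text \<open>
  The bound comes from one explicit irredundant cover for each \<open>m \<ge> 4\<close>, made of a frame and a
  diagonal pattern.

  In the infinite grid, the cards \<open>block a b\<close> with \<open>a + b\<close> congruent to \<open>0\<close> or \<open>3\<close> modulo \<open>4\<close> form
  diagonal stripes of density one half. The four cards through a square \<open>(i, j)\<close> have coordinate sums
  \<open>s - 2\<close>, \<open>s - 1\<close>, \<open>s - 1\<close>, \<open>s\<close> with \<open>s = i + j\<close>. Hence every square lies in one or three chosen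
  cards, and it lies in exactly one when \<open>s\<close> is \<open>2\<close> or \<open>3\<close> modulo \<open>4\<close>, that is, when
  \<open>(i + j) div 2\<close> is odd. These private squares again have density one half, and each card gets one
  of them. This is the source of the leading term \<open>m\<^sup>2 / 2\<close>.

  Cutting the pattern off at the border of \<open>G\<^sub>m\<close> would leave border squares uncovered. Instead,
  the two outermost rings of squares are covered by a closed frame of cards, laid almost without
  overlap, whose private squares lie on the outermost ring. Frame cards miss the central square
  \<open>{3..m-2} \<times> {3..m-2}\<close>, and the cards serving private squares of the central square miss the
  outermost ring. So neither part touches the private squares of the other. For the central part one
  keeps just those cards of the pattern whose private square is central. They still cover the central
  square: only its corners are at risk, and the phase of the pattern is chosen so that these are safe.

  The frame has at least \<open>2 * m - 4\<close> cards, and the central part has at least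
  \<open>((m - 4)\<^sup>2 - 1) / 2\<close>, since the signed count of private against other squares depends only on
  \<open>m\<close> modulo \<open>4\<close>. Together these exceed \<open>m\<^sup>2 / 2 - 2 * m + 3\<close>. For \<open>m = 2\<close> and \<open>m = 3\<close> the
  weaker bound is negative.

  The cover is described from its private squares: a set \<open>X\<close> of squares and a map assigning to each of
  them the position of the card that it is private for (lemma \<open>F_ge_card\<close>). Then the number of
  cards is the number of elements of \<open>X\<close>.
\<close>

section \<open>Irredundant covers from their private squares\<close>

lemma mem_block_iff:
  "(i, j) \<in> block a b \<longleftrightarrow> (i = a \<or> i = Suc a) \<and> (j = b \<or> j = Suc b)"
  by (auto simp: block_def)

lemma finite_blocks: "finite (blocks m)"
proof -
  have "blocks m \<subseteq> (\<lambda>(a, b). block a b) ` ({1..m-1} \<times> {1..m-1})"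
    by (auto simp: blocks_def)
  then show ?thesis
    by (rule finite_subset) simp
qed

text \<open>Condition \<open>priv\<close> says both that every \<open>x\<close> lies in its own card and that it lies in no other one;
  in particular different squares of \<open>X\<close> have different cards.\<close>

lemma F_ge_card:
  fixes X :: "(nat \<times> nat) set" and c :: "nat \<times> nat \<Rightarrow> nat \<times> nat"
  assumes ne: "X \<noteq> {}"
    and pos: "\<And>x. x \<in> X \<Longrightarrow> c x \<in> {1..m-1} \<times> {1..m-1}"
    and priv: "\<And>x y. x \<in> X \<Longrightarrow> y \<in> X \<Longrightarrow> x \<in> case_prod block (c y) \<longleftrightarrow> x = y"
    and cover: "\<And>z. z \<in> grid m \<Longrightarrow> \<exists>x\<in>X. z \<in> case_prod block (c x)"
  shows "card X \<le> F m"
proof -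
  define B where "B x = case_prod block (c x)" for x
  define U where "U = B ` X"
  have sub: "U \<subseteq> blocks m"
  proof
    fix C assume "C \<in> U"
    then obtain x where "x \<in> X" "C = B x" by (auto simp: U_def)
    moreover obtain a b where "c x = (a, b)" by (metis surj_pair)
    ultimately show "C \<in> blocks m"
      using pos[of x] unfolding B_def blocks_def by auto
  qed
  then have fin: "finite U"
    using finite_blocks finite_subset by blast
  have mem_B: "x \<in> B y \<longleftrightarrow> x = y" if "x \<in> X" "y \<in> X" for x y
    using priv[OF that] by (simp only: B_def)
  have inj: "inj_on B X"
  proof (rule inj_onI)
    fix x y assume xy: "x \<in> X" "y \<in> X" and eq: "B x = B y"
    then show "x = y" using mem_B[OF xy] mem_B[OF xy(1,1)] by simp
  qed
  have conf: "configuration m U"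
    using ne sub by (auto simp: configuration_def U_def)
  have covers: "multiplicity U z \<ge> 1" if z: "z \<in> grid m" for z
  proof -
    obtain x where "x \<in> X" "z \<in> B x" using cover[OF z] by (auto simp: B_def)
    then have "{C \<in> U. z \<in> C} \<noteq> {}" by (auto simp: U_def)
    then have "card {C \<in> U. z \<in> C} > 0" using fin by (simp add: card_gt_0_iff)
    then show ?thesis by (simp add: multiplicity_def)
  qed
  have privs: "\<exists>x. private_square U C x" if C: "C \<in> U" for C
  proof -
    obtain x where x: "x \<in> X" "C = B x" using C by (auto simp: U_def)
    have "{C' \<in> U. x \<in> C'} = {C}"
      unfolding U_def x(2) using mem_B[OF x(1)] x(1) by blast
    then have "private_square U C x"
      by (auto simp: private_square_def multiplicity_def)
    then show ?thesis ..
  qed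
  have irr: "irredundant_cover m U"
    using conf covers privs by (simp add: irredundant_cover_def)
  have "{card U' | U'. irredundant_cover m U'} \<subseteq> card ` Pow (blocks m)"
    by (auto simp: irredundant_cover_def configuration_def)
  then have "finite {card U' | U'. irredundant_cover m U'}"
    using finite_blocks by (meson finite_Pow_iff finite_imageI finite_subset)
  then have "card U \<le> F m"
    unfolding F_def using irr by (intro Max_ge) auto
  then show ?thesis
    using card_image[OF inj] by (simp add: U_def)
qed

section \<open>The frame\<close>

text \<open>The one-dimensional model of the frame: intervals \<open>{k, k + 1}\<close> laid end to end from \<open>1\<close>, together
  with a last interval \<open>{m - 1, m}\<close>, which overlaps the one before it when \<open>m\<close> is odd. Every interval
  is represented by its private point, its left end except for the last interval.\<close>

definition tile_points :: "nat \<Rightarrow> nat set" where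
  "tile_points m = {i. i = m \<or> (odd i \<and> i + 1 < m)}"

definition tile_start :: "nat \<Rightarrow> nat \<Rightarrow> nat" where
  "tile_start m i = (if i = m then m - 1 else i)"

lemma tile_private:
  assumes "m \<ge> 2" "i \<in> tile_points m" "k \<in> tile_points m"
  shows "i = tile_start m k \<or> i = Suc (tile_start m k) \<longleftrightarrow> i = k"
  using assms by (auto simp: tile_points_def tile_start_def split: if_splits)

lemma tile_start_bounds:
  assumes "m \<ge> 2" "i \<in> tile_points m"
  shows "Suc 0 \<le> tile_start m i" "tile_start m i \<le> m - Suc 0"
  using assms by (auto simp: tile_points_def tile_start_def intro: Suc_leI odd_pos)

lemma tile_cover:
  assumes "m \<ge> 2" "i \<in> {1..m}"
  shows "\<exists>k\<in>tile_points m. i = tile_start m k \<or> i = Suc (tile_start m k)"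
proof -
  consider "i + 1 \<ge> m" | "odd i" "i + 1 < m" | "even i" "i + 1 < m"
    by linarith
  then show ?thesis
  proof cases
    case 1
    then show ?thesis using assms
      by (intro bexI[of _ m]) (auto simp: tile_points_def tile_start_def)
  next
    case 2
    then show ?thesis
      by (intro bexI[of _ i]) (auto simp: tile_points_def tile_start_def)
  next
    case 3
    then show ?thesis using assms
      by (intro bexI[of _ "i - 1"]) (auto simp: tile_points_def tile_start_def)
  qed
qed

lemma finite_tile_points: "finite (tile_points m)"
  by (rule finite_subset[of _ "{..m}"]) (auto simp: tile_points_def)

text \<open>The intervals have two points each and cover \<open>{1..m}\<close>.\<close>

lemma card_tile_points:
  assumes "m \<ge> 2"
  shows "m \<le> 2 * card (tile_points m)"
proof -
  let ?T = "tile_points m" and ?d = "tile_start m"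
  have "{1..m} \<subseteq> ?d ` ?T \<union> (Suc \<circ> ?d) ` ?T"
    using tile_cover[OF assms] by fastforce
  then have "card {1..m} \<le> card (?d ` ?T \<union> (Suc \<circ> ?d) ` ?T)"
    by (intro card_mono) (simp_all add: finite_tile_points)
  also have "\<dots> \<le> card (?d ` ?T) + card ((Suc \<circ> ?d) ` ?T)"
    by (rule card_Un_le)
  also have "\<dots> \<le> card ?T + card ?T"
    by (intro add_mono card_image_le finite_tile_points)
  finally show ?thesis by simp
qed

text \<open>The private squares of the frame. The frame consists of the border cards of the product of
  two one-dimensional tilings, so that privacy can be checked in each coordinate separately.\<close>

definition frame :: "nat \<Rightarrow> (nat \<times> nat) set" where
  "frame m = {(i, j) \<in> tile_points m \<times> tile_points m. i \<in> {1, m} \<or> j \<in> {1, m}}"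

lemma card_frame:
  assumes "m \<ge> 4"
  shows "card (frame m) + 4 \<ge> 2 * m"
proof -
  let ?T = "tile_points m"
  let ?T' = "?T - {1, m}"
  have mem: "{1, m} \<subseteq> ?T" using assms by (auto simp: tile_points_def)
  have card2: "card {1, m} = 2" using assms by simp
  have "card ?T' = card ?T - 2"
    using mem card2 by (simp add: card_Diff_subset)
  moreover have ge: "card ?T \<ge> 2"
    using card_mono[OF finite_tile_points mem] card2 by simp
  ultimately have T': "card ?T = card ?T' + 2" by simp
  have "card (?T \<times> ?T) = card (frame m \<union> ?T' \<times> ?T')"
    by (intro arg_cong[of _ _ card]) (auto simp: frame_def)
  also have "\<dots> = card (frame m) + card (?T' \<times> ?T')"
  proof (rule card_Un_disjoint)
    show "finite (frame m)"
      by (rule finite_subset[of _ "?T \<times> ?T"]) (auto simp: frame_def finite_tile_points)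
  qed (auto simp: frame_def finite_tile_points)
  finally have "(card ?T' + 2) * (card ?T' + 2) = card (frame m) + card ?T' * card ?T'"
    by (simp only: card_cartesian_product T')
  then have "card (frame m) = 4 * card ?T' + 4" by (simp add: algebra_simps)
  moreover have "m \<le> 2 * (card ?T' + 2)"
    using card_tile_points[of m] assms T' by simp
  ultimately show ?thesis by simp
qed

section \<open>The diagonal pattern\<close>

definition diag :: "nat \<Rightarrow> (nat \<times> nat) set" where
  "diag m = {(i, j) \<in> {3..m-2} \<times> {3..m-2}. odd ((i + j) div 2)}"

text \<open>The position of the only card of the diagonal pattern that contains a private square: the square
  is the lower right corner of the card if its coordinate sum is \<open>2\<close> modulo \<open>4\<close>, and the upper left
  corner if that sum is \<open>3\<close> modulo \<open>4\<close>.\<close>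

definition diag_card :: "nat \<times> nat \<Rightarrow> nat \<times> nat" where
  "diag_card = (\<lambda>(i, j). if even (i + j) then (i - 1, j - 1) else (i, j))"

text \<open>The card of \<open>y\<close> has \<open>y\<close> as its lower right or upper left corner. Its other three squares have
  coordinate sums one or two below that of \<open>y\<close> in the first case and one or two above it in the second
  case, hence \<open>0\<close> or \<open>1\<close> modulo \<open>4\<close>, so that none of them is in \<open>diag m\<close>.\<close>

lemma diag_private:
  assumes "x \<in> diag m" "y \<in> diag m"
  shows "x \<in> case_prod block (diag_card y) \<longleftrightarrow> x = y"
proof -
  obtain i j k l where xy: "x = (i, j)" "y = (k, l)" by (metis surj_pair)
  have x: "i \<ge> 3" "j \<ge> 3" "odd ((i + j) div 2)"
   and y: "k \<ge> 3" "l \<ge> 3" "odd ((k + l) div 2)"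
    using assms by (auto simp: diag_def xy)
  have below: "odd (s div 2) \<Longrightarrow> even (s + 1) \<Longrightarrow> even ((s + 1) div 2)"
      "odd (s div 2) \<Longrightarrow> even (s + 2) \<Longrightarrow> even ((s + 2) div 2)" for s :: nat
    by presburger+
  have above: "odd (s div 2) \<Longrightarrow> odd s \<Longrightarrow> even ((s + 1) div 2)"
      "odd (s div 2) \<Longrightarrow> odd s \<Longrightarrow> even ((s + 2) div 2)" for s :: nat
    by presburger+
  show ?thesis
  proof (cases "even (k + l)")
    case True
    have "i = k \<and> j = l" if ij: "i = k - 1 \<or> i = k" "j = l - 1 \<or> j = l"
    proof -
      have "i + j + 1 \<noteq> k + l" "i + j + 2 \<noteq> k + l"
        using x(3) y(3) True below by metis+
      then show ?thesis using ij x y(1,2) by linarith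
    qed
    then show ?thesis using True y by (auto simp: xy diag_card_def mem_block_iff)
  next
    case False
    have "i = k \<and> j = l" if ij: "i = k \<or> i = Suc k" "j = l \<or> j = Suc l"
    proof -
      have "i + j \<noteq> k + l + 1" "i + j \<noteq> k + l + 2"
        using x(3) y(3) False above by metis+
      then show ?thesis using ij by linarith
    qed
    then show ?thesis using False by (auto simp: xy diag_card_def mem_block_iff)
  qed
qed

text \<open>A square that is not private has coordinate sum \<open>0\<close> or \<open>1\<close> modulo \<open>4\<close> and lies in three cards of
  the infinite pattern. Two of them have their private squares next to it: above and to the left if the
  sum is \<open>0\<close>, below and to the right if the sum is \<open>1\<close>. At least one of these two is a central square,
  unless the given square is the upper left corner in the first case or the lower right corner in the
  second case. But the upper left corner \<open>(3, 3)\<close> has sum \<open>6\<close>, and the lower right corner has an even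
  sum.\<close>

lemma diag_cover:
  assumes "i \<in> {3..m-2}" "j \<in> {3..m-2}"
  shows "\<exists>x\<in>diag m. (i, j) \<in> case_prod block (diag_card x)"
proof -
  have bd: "i \<ge> 3" "j \<ge> 3" "i \<le> m - 2" "j \<le> m - 2"
    using assms by auto
  have "odd (s div 2) \<or> s mod 4 = 0 \<or> s mod 4 = 1" for s :: nat
    by presburger
  from this[of "i + j"] consider "odd ((i + j) div 2)" | "(i + j) mod 4 = 0" | "(i + j) mod 4 = 1"
    by metis
  then show ?thesis
  proof cases
    case 1
    then show ?thesis using bd
      by (intro bexI[of _ "(i, j)"]) (auto simp: diag_def diag_card_def mem_block_iff)
  next
    case 2
    have "\<not> (i = 3 \<and> j = 3)" using 2 by auto
    then consider "i \<ge> 4" | "j \<ge> 4" using bd by linarith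
    then show ?thesis
    proof cases
      case 1
      have "odd ((i - 1 + j) div 2)" "odd (i - 1 + j)" using 1 2 by presburger+
      then show ?thesis using bd 1
        by (intro bexI[of _ "(i - 1, j)"]) (auto simp: diag_def diag_card_def mem_block_iff)
    next
      case 2
      have "odd ((i + (j - 1)) div 2)" "odd (i + (j - 1))"
        using 2 \<open>(i + j) mod 4 = 0\<close> by presburger+
      then show ?thesis using bd 2
        by (intro bexI[of _ "(i, j - 1)"]) (auto simp: diag_def diag_card_def mem_block_iff)
    qed
  next
    case 3
    have "(2 * k) mod 4 \<noteq> 1" for k :: nat by presburger
    from this[of "m - 2"] have "\<not> (i = m - 2 \<and> j = m - 2)" using 3 by (auto simp: mult_2)
    then consider "i + 1 \<le> m - 2" | "j + 1 \<le> m - 2" using bd by linarith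
    then show ?thesis
    proof cases
      case 1
      have "odd ((i + 1 + j) div 2)" "even (i + 1 + j)" using 3 by presburger+
      then show ?thesis using bd 1
        by (intro bexI[of _ "(i + 1, j)"]) (auto simp: diag_def diag_card_def mem_block_iff)
    next
      case 2
      have "odd ((i + (j + 1)) div 2)" "even (i + (j + 1))" using 3 by presburger+
      then show ?thesis using bd 2
        by (intro bexI[of _ "(i, j + 1)"]) (auto simp: diag_def diag_card_def mem_block_iff)
    qed
  qed
qed

definition diag_sign :: "nat \<Rightarrow> int" where
  "diag_sign k = (if even (k div 2) then 1 else -1)"

lemma diag_sign_period:
  "diag_sign k + diag_sign (k + 1) + diag_sign (k + 2) + diag_sign (k + 3) = 0"
proof -
  have "even ((k + 2) div 2) \<longleftrightarrow> odd (k div 2)" "even ((k + 3) div 2) \<longleftrightarrow> odd ((k + 1) div 2)"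
    by presburger+
  then show ?thesis by (simp add: diag_sign_def)
qed

text \<open>The number of private squares minus the number of other squares in an \<open>n \<times> n\<close> square of the
  pattern, with coordinates counted from the corner \<open>(3, 3)\<close> of the central square.\<close>

definition signed_count :: "nat \<Rightarrow> int" where
  "signed_count n = (\<Sum>u<n. \<Sum>v<n. diag_sign (u + v))"

text \<open>Four consecutive signs cancel in every row and in every column, so that four more rows and
  columns do not change the signed count.\<close>

lemma signed_count_add_4: "signed_count (n + 4) = signed_count n"
proof -
  have four: "(\<Sum>v<n + 4. f v) = (\<Sum>v<n. f v)"
    if "f n + f (n + 1) + f (n + 2) + f (n + 3) = 0" for f :: "nat \<Rightarrow> int"
    using that by (simp add: numeral_eq_Suc)
  have row: "(\<Sum>v<n + 4. diag_sign (u + v)) = (\<Sum>v<n. diag_sign (u + v))" for u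
    using diag_sign_period[of "u + n"] by (intro four) (simp add: add.assoc)
  have col: "(\<Sum>v<n. diag_sign (n + v)) + (\<Sum>v<n. diag_sign (n + 1 + v))
      + (\<Sum>v<n. diag_sign (n + 2 + v)) + (\<Sum>v<n. diag_sign (n + 3 + v)) = 0"
  proof -
    have "(\<Sum>v<n. diag_sign (n + v) + diag_sign (n + v + 1)
        + diag_sign (n + v + 2) + diag_sign (n + v + 3)) = 0"
      by (simp only: diag_sign_period sum.neutral_const)
    then show ?thesis by (simp add: sum.distrib ac_simps)
  qed
  show ?thesis
    unfolding signed_count_def row by (rule four[OF col])
qed

lemma signed_count_ge: "signed_count n \<ge> -1"
proof (induction n rule: less_induct)
  case (less n)
  show ?case
  proof (cases "n < 4")
    case True
    then have "n \<in> {0, 1, 2, 3}" by auto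
    then show ?thesis
      by (auto simp: signed_count_def diag_sign_def lessThan_nat_numeral lessThan_Suc)
  next
    case False
    then show ?thesis
      using less[of "n - 4"] signed_count_add_4[of "n - 4"] by simp
  qed
qed

lemma card_diag:
  assumes "m \<ge> 4"
  shows "2 * int (card (diag m)) \<ge> (int m - 4)\<^sup>2 - 1"
proof -
  define n where "n = m - 4"
  define A where "A = {p \<in> {..<n} \<times> {..<n}. even ((fst p + snd p) div 2)}"
  have n: "int n = int m - 4" using assms by (simp add: n_def)
  \<comment> \<open>The shift by \<open>3\<close> in both coordinates changes the coordinate sum by \<open>6\<close>, which reverses the
    parity of its half.\<close>
  have "diag m = (\<lambda>(u, v). (u + 3, v + 3)) ` A"
  proof (intro set_eqI iffI)
    fix x assume "x \<in> diag m"
    then obtain i j where x: "x = (i, j)" "i \<ge> 3" "i \<le> m - 2" "j \<ge> 3" "j \<le> m - 2"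
        "odd ((i + j) div 2)"
      by (auto simp: diag_def)
    have "even ((i - 3 + (j - 3)) div 2)" using x by presburger
    then have "(i - 3, j - 3) \<in> A" using x by (auto simp: A_def n_def)
    then show "x \<in> (\<lambda>(u, v). (u + 3, v + 3)) ` A"
      using x by (intro image_eqI[of _ _ "(i - 3, j - 3)"]) auto
  next
    fix x assume "x \<in> (\<lambda>(u, v). (u + 3, v + 3)) ` A"
    then obtain u v where x: "x = (u + 3, v + 3)" "u < n" "v < n" "even ((u + v) div 2)"
      by (auto simp: A_def)
    have "odd ((u + 3 + (v + 3)) div 2)" using x by presburger
    then show "x \<in> diag m" using x by (auto simp: diag_def n_def)
  qed
  then have card: "card (diag m) = card A"
    by (simp add: card_image inj_on_def split_def prod_eq_iff)
  have "(\<Sum>p\<in>{..<n} \<times> {..<n}. if even ((fst p + snd p) div 2) then 1 else 0) = int (card A)"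
    unfolding A_def by (subst sum.inter_filter[symmetric]) simp_all
  then have "2 * int (card A) = (\<Sum>u<n. \<Sum>v<n. 2 * (if even ((u + v) div 2) then 1 else 0))"
    by (simp add: sum.cartesian_product split_def flip: sum_distrib_left)
  also have "\<dots> = (\<Sum>u<n. \<Sum>v<n. 1 + diag_sign (u + v))"
    by (intro sum.cong) (auto simp: diag_sign_def)
  also have "\<dots> = (int n)\<^sup>2 + signed_count n"
    by (simp add: signed_count_def sum.distrib power2_eq_square)
  finally show ?thesis
    using signed_count_ge[of n] card n by simp
qed

section \<open>Putting frame and pattern together\<close>

definition frame_card :: "nat \<Rightarrow> nat \<times> nat \<Rightarrow> nat \<times> nat" where
  "frame_card m = (\<lambda>(i, j). (tile_start m i, tile_start m j))"

definition cover_card :: "nat \<Rightarrow> nat \<times> nat \<Rightarrow> nat \<times> nat" where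
  "cover_card m x = (if x \<in> diag m then diag_card x else frame_card m x)"

lemma frame_private:
  assumes "m \<ge> 2" "x \<in> frame m" "y \<in> frame m"
  shows "x \<in> case_prod block (frame_card m y) \<longleftrightarrow> x = y"
proof -
  obtain i j k l where xy: "x = (i, j)" "y = (k, l)" by (metis surj_pair)
  have "i \<in> tile_points m" "j \<in> tile_points m" "k \<in> tile_points m" "l \<in> tile_points m"
    using assms by (auto simp: frame_def xy)
  then show ?thesis
    using tile_private[OF \<open>m \<ge> 2\<close>] by (simp add: xy frame_card_def mem_block_iff)
qed

lemma frame_cover:
  assumes "m \<ge> 4" "(i, j) \<in> grid m" "(i, j) \<notin> {3..m-2} \<times> {3..m-2}"
  shows "\<exists>x\<in>frame m. (i, j) \<in> case_prod block (frame_card m x)"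
proof -
  have ij: "i \<in> {1..m}" "j \<in> {1..m}" using assms by (auto simp: grid_def)
  \<comment> \<open>In the two outermost rows or columns, the interval may be chosen to be an outermost one.\<close>
  have outer: "\<exists>k\<in>tile_points m. (k' = tile_start m k \<or> k' = Suc (tile_start m k)) \<and> k \<in> {1, m}"
    if "k' \<in> {1..m}" "k' \<notin> {3..m-2}" for k'
  proof -
    from that have "k' \<in> {1, 2} \<or> k' \<in> {m - 1, m}" by auto
    then show ?thesis
    proof
      assume "k' \<in> {1, 2}"
      then show ?thesis using \<open>m \<ge> 4\<close>
        by (intro bexI[of _ 1]) (auto simp: tile_points_def tile_start_def)
    next
      assume "k' \<in> {m - 1, m}"
      then show ?thesis using \<open>m \<ge> 4\<close>
        by (intro bexI[of _ m]) (auto simp: tile_points_def tile_start_def)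
    qed
  qed
  have "m \<ge> 2" using assms by simp
  note any = tile_cover[OF this]
  obtain k l where "k \<in> tile_points m" "i = tile_start m k \<or> i = Suc (tile_start m k)"
      "l \<in> tile_points m" "j = tile_start m l \<or> j = Suc (tile_start m l)"
      "k \<in> {1, m} \<or> l \<in> {1, m}"
  proof (cases "i \<in> {3..m-2}")
    case True
    then have "j \<notin> {3..m-2}" using assms(3) by simp
    with any[OF ij(1)] outer[OF ij(2)] show ?thesis using that by blast
  next
    case False
    with outer[OF ij(1)] any[OF ij(2)] show ?thesis using that by blast
  qed
  then show ?thesis
    by (intro bexI[of _ "(k, l)"]) (auto simp: frame_def frame_card_def mem_block_iff)
qed

lemma frame_diag_separate:
  assumes "m \<ge> 4" "x \<in> frame m" "y \<in> diag m"
  shows "x \<noteq> y" "x \<notin> case_prod block (diag_card y)" "y \<notin> case_prod block (frame_card m x)"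
proof -
  obtain i j k l where xy: "x = (i, j)" "y = (k, l)" by (metis surj_pair)
  have x: "i \<in> {1, m} \<or> j \<in> {1, m}" using assms by (auto simp: frame_def xy)
  have y: "3 \<le> k" "k \<le> m - 2" "3 \<le> l" "l \<le> m - 2" using assms by (auto simp: diag_def xy)
  show "x \<noteq> y" using x y \<open>m \<ge> 4\<close> by (auto simp: xy)
  show "x \<notin> case_prod block (diag_card y)"
    using x y \<open>m \<ge> 4\<close> by (auto simp: xy diag_card_def mem_block_iff)
  show "y \<notin> case_prod block (frame_card m x)"
    using x y \<open>m \<ge> 4\<close> by (auto simp: xy frame_card_def tile_start_def mem_block_iff)
qed

lemma F_ge_card_frame_diag:
  assumes "m \<ge> 4"
  shows "card (frame m) + card (diag m) \<le> F m"
proof -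
  let ?X = "frame m \<union> diag m"
  note sep = frame_diag_separate[OF assms]
  have fr: "cover_card m x = frame_card m x" if "x \<in> frame m" for x
    using sep(1)[OF that, of x] unfolding cover_card_def by metis
  have di: "cover_card m x = diag_card x" if "x \<in> diag m" for x
    using that by (simp add: cover_card_def)
  have "card ?X \<le> F m"
  proof (rule F_ge_card[where c = "cover_card m"])
    have "(m, m) \<in> frame m" by (simp add: frame_def tile_points_def)
    then show "?X \<noteq> {}" by blast
  next
    fix x assume "x \<in> ?X"
    then show "cover_card m x \<in> {1..m-1} \<times> {1..m-1}"
    proof
      assume "x \<in> frame m"
      then show ?thesis using assms fr
        by (auto simp: frame_def frame_card_def intro!: tile_start_bounds)
    next
      assume "x \<in> diag m"
      then show ?thesis using di by (auto simp: diag_def diag_card_def)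
    qed
  next
    fix x y assume "x \<in> ?X" "y \<in> ?X"
    then consider "x \<in> frame m" "y \<in> frame m" | "x \<in> frame m" "y \<in> diag m"
      | "x \<in> diag m" "y \<in> frame m" | "x \<in> diag m" "y \<in> diag m"
      by blast
    then show "x \<in> case_prod block (cover_card m y) \<longleftrightarrow> x = y"
    proof cases
      case 1
      then show ?thesis using frame_private assms by (simp only: fr)
    next
      case 2
      then show ?thesis using sep(1,2)[OF 2] by (simp add: di)
    next
      case 3
      then show ?thesis using sep(1,3)[OF 3(2,1)] by (simp add: fr)
    next
      case 4
      then show ?thesis using diag_private by (simp only: di)
    qed
  next
    fix z assume z: "z \<in> grid m"
    obtain i j where ij: "z = (i, j)" by (metis surj_pair)
    show "\<exists>x\<in>?X. z \<in> case_prod block (cover_card m x)"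
    proof (cases "z \<in> {3..m-2} \<times> {3..m-2}")
      case True
      then obtain x where "x \<in> diag m" "z \<in> case_prod block (diag_card x)"
        using diag_cover[of i m j] unfolding ij mem_Sigma_iff by metis
      then show ?thesis by (intro bexI[of _ x]) (simp_all only: di UnI2)
    next
      case False
      then obtain x where "x \<in> frame m" "z \<in> case_prod block (frame_card m x)"
        using frame_cover[OF assms, of i j] z unfolding ij by metis
      then show ?thesis by (intro bexI[of _ x]) (simp_all only: fr UnI1)
    qed
  qed
  moreover have "card ?X = card (frame m) + card (diag m)"
  proof (rule card_Un_disjoint)
    show "finite (frame m)"
      by (rule finite_subset[of _ "tile_points m \<times> tile_points m"])
        (auto simp: frame_def finite_tile_points)
    show "finite (diag m)"
      by (rule finite_subset[of _ "{3..m-2} \<times> {3..m-2}"]) (auto simp: diag_def)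
    show "frame m \<inter> diag m = {}" using sep(1) by (metis disjoint_iff)
  qed
  ultimately show ?thesis by simp
qed

lemma F_lower_bound:
  assumes "m \<ge> 4"
  shows "real (F m) \<ge> 1 / 2 * (real m)\<^sup>2 - 2 * real m + 3"
proof -
  have "2 * int m \<le> int (card (frame m)) + 4"
    using card_frame[OF assms] by linarith
  moreover have "int (card (frame m)) + int (card (diag m)) \<le> int (F m)"
    using F_ge_card_frame_diag[OF assms] by linarith
  moreover have "(int m - 4)\<^sup>2 - 1 = (int m)\<^sup>2 - 8 * int m + 15"
    by (simp add: power2_eq_square algebra_simps)
  ultimately have "2 * int (F m) \<ge> (int m)\<^sup>2 - 4 * int m + 7"
    using card_diag[OF assms] by linarith
  then have "real_of_int (2 * int (F m)) \<ge> real_of_int ((int m)\<^sup>2 - 4 * int m + 7)"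
    by (simp only: of_int_le_iff)
  then show ?thesis by simp
qed

lemma F_lower_bound_weak:
  assumes "m \<ge> 2"
  shows "real (F m) \<ge> 1 / 2 * (real m)\<^sup>2 - 2 * real m"
proof (cases "m \<ge> 4")
  case True
  then show ?thesis using F_lower_bound[of m] by simp
next
  case False
  then have "real m * (real m - 4) \<le> 0" by (intro mult_nonneg_nonpos) auto
  then have "1 / 2 * (real m)\<^sup>2 - 2 * real m \<le> 0"
    by (simp add: power2_eq_square algebra_simps)
  then show ?thesis using of_nat_0_le_iff[of "F m"] by linarith
qed

theorem theorem4p3:
  shows "(\<forall>m::nat. m \<ge> 6 \<longrightarrow> real (F m) \<ge> 1 / 2 * (real m)^2 - 2 * real m + 3)
    \<and> (\<forall>m::nat. m \<ge> 2 \<longrightarrow> real (F m) \<ge> 1 / 2 * (real m)^2 - 2 * real m)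
    \<and> liminf (\<lambda>m. ereal (real (F m) / (real m)^2)) \<ge> ereal (1 / 2)"
proof (intro conjI allI impI)
  fix m :: nat assume "m \<ge> 6"
  then show "real (F m) \<ge> 1 / 2 * (real m)^2 - 2 * real m + 3"
    by (intro F_lower_bound) simp
next
  fix m :: nat assume "m \<ge> 2"
  then show "real (F m) \<ge> 1 / 2 * (real m)^2 - 2 * real m"
    by (rule F_lower_bound_weak)
next
  let ?g = "\<lambda>m::nat. 1 / 2 - 2 / real m"
  have le: "?g m \<le> real (F m) / (real m)^2" if "m \<ge> 2" for m
  proof -
    have "?g m = (1 / 2 * (real m)^2 - 2 * real m) / (real m)^2"
      using that by (simp add: field_simps power2_eq_square)
    also have "\<dots> \<le> real (F m) / (real m)^2"
      by (intro divide_right_mono F_lower_bound_weak that) simp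
    finally show ?thesis .
  qed
  have "?g \<longlonglongrightarrow> 1 / 2 - 0"
    by (intro tendsto_diff tendsto_const lim_const_over_n)
  then have "liminf (\<lambda>m. ereal (?g m)) = ereal (1 / 2)"
    by (intro lim_imp_Liminf) (simp_all add: tendsto_ereal)
  moreover have "liminf (\<lambda>m. ereal (?g m)) \<le> liminf (\<lambda>m. ereal (real (F m) / (real m)^2))"
    by (intro Liminf_mono eventually_sequentiallyI[of 2]) (simp only: ereal_less_eq le)
  ultimately show "liminf (\<lambda>m. ereal (real (F m) / (real m)^2)) \<ge> ereal (1 / 2)"
    by simp
qed

end
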